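(* Let $P$ be an ergodic Markov kernel on a finite set $\mathcal X$, reversible with respect to the strictly positive probability distribution $\pi$, and let $\mathcal O=\{O_1,\ldots,O_k\}$ be a partition of $\mathcal X$ into $k$ nonempty blocks. Let $(X_t)_{t\ge 0}$ be a Markov chain with transition kernel $P$ and $X_0\sim\pi$, let $Z\in\{1,\ldots,k\}$ be defined by $Z=i\iff X_0\in O_i$, and let $\pi_i=\pi(\cdot\mid O_i)$. Then $F(\mathcal O):=\|G_{\mathcal O}P-\Pi\|_{F,\pi}^2$ satisfies $$F(\mathcal O)=\sum_{i=1}^k\pi(O_i)\,\chi^2(\pi_iP\,\|\,\pi)=I_{\chi^2}(Z;X_1).$$ In particular, $F(\mathcal O)=0$ if and only if $Z$ and $X_1$ are independent. Moreover $I_{\chi^2}(Z;X_0)=k-1$, and $$\operatorname{Ncut}_{P^2}(\mathcal O)=I_{\chi^2}(Z;X_0)-I_{\chi^2}(Z;X_1).$$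
   Context: $\mathcal X$ is a finite set with $n=|\mathcal X|\ge 3$ and $\pi(x)>0$ for all $x$. $\ell^2(\pi)$ is the space of real functions on $\mathcal X$ with $\langle f,g\rangle_\pi=\sum_x\pi(x)f(x)g(x)$. Ergodic means irreducible and aperiodic; reversible means $\pi(x)P(x,y)=\pi(y)P(y,x)$ for all $x,y$. $\Pi(x,y)=\pi(y)$. The Gibbs kernel of $\mathcal O$ is $G_{\mathcal O}(x,y)=\sum_{i=1}^k\mathbf 1_{O_i}(x)\mathbf 1_{O_i}(y)\pi(y)/\pi(O_i)$. For an operator $A$ on $\ell^2(\pi)$, $\|A\|_{F,\pi}^2=\operatorname{Tr}(A^*A)=\sum_{x,y}\frac{\pi(x)}{\pi(y)}A(x,y)^2$. For probability distributions $\mu,\nu$ on the same finite set with $\nu$ strictly positive, $\chi^2(\mu\|\nu)=\sum_y(\mu(y)-\nu(y))^2/\nu(y)$. For finite-valued random variables $U,V$, $I_{\chi^2}(U;V)=\chi^2(\mathcal L(U,V)\,\|\,\mathcal L(U)\otimes\mathcal L(V))$, where $\mathcal L$ denotes the law and $\otimes$ the product measure. For an entrywise nonnegative matrix $B$, $\operatorname{Ncut}_B(\mathcal O)=\sum_{i=1}^k\frac{1}{\pi(O_i)}\sum_{x\in O_i}\sum_{y\in O_i^c}\pi(x)B(x,y)$. $\pi_iP$ is the distribution $y\mapsto\sum_x\pi_i(x)P(x,y)$. *)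

theory Defs
  imports "HOL-Probability.Probability"
begin

section \<open>Markov kernels on a finite state space\<close>

definition kernel_matrix :: "('a::finite \<Rightarrow> 'a pmf) \<Rightarrow> real^'a^'a" where
  "kernel_matrix P = (\<chi> x y. pmf (P x) y)"

text \<open>The class operation \<open>^\<close> on \<open>real^'a^'a\<close> would be the componentwise power.\<close>

definition matrix_power :: "real^'a^'a \<Rightarrow> nat \<Rightarrow> real^'a::finite^'a" where
  "matrix_power A m = (((**) A) ^^ m) (mat 1)"

definition irreducible_kernel :: "('a::finite \<Rightarrow> 'a pmf) \<Rightarrow> bool" where
  "irreducible_kernel P \<longleftrightarrow> (\<forall>x y. \<exists>m. matrix_power (kernel_matrix P) m $ x $ y > 0)"

definition aperiodic_kernel :: "('a::finite \<Rightarrow> 'a pmf) \<Rightarrow> bool" where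
  "aperiodic_kernel P \<longleftrightarrow>
     (\<forall>x. Gcd {m. m > 0 \<and> matrix_power (kernel_matrix P) m $ x $ x > 0} = 1)"

definition ergodic_kernel :: "('a::finite \<Rightarrow> 'a pmf) \<Rightarrow> bool" where
  "ergodic_kernel P \<longleftrightarrow> irreducible_kernel P \<and> aperiodic_kernel P"

definition reversible_kernel :: "'a pmf \<Rightarrow> ('a \<Rightarrow> 'a pmf) \<Rightarrow> bool" where
  "reversible_kernel \<pi> P \<longleftrightarrow> (\<forall>x y. pmf \<pi> x * pmf (P x) y = pmf \<pi> y * pmf (P y) x)"

definition markov_chain ::
    "'w measure \<Rightarrow> ('a::finite \<Rightarrow> 'a pmf) \<Rightarrow> (nat \<Rightarrow> 'w \<Rightarrow> 'a) \<Rightarrow> bool" where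
  "markov_chain M P X \<longleftrightarrow>
     prob_space M \<and>
     (\<forall>t. X t \<in> measurable M (count_space UNIV)) \<and>
     (\<forall>t x y. \<P>(\<omega> in M. \<forall>s\<le>t. X s \<omega> = x s) > 0 \<longrightarrow>
        \<P>(\<omega> in M. X (Suc t) \<omega> = y \<bar> \<forall>s\<le>t. X s \<omega> = x s) = pmf (P (x t)) y)"

section \<open>Operators on the weighted space of real functions\<close>

definition pi_inner :: "'a pmf \<Rightarrow> real^'a::finite \<Rightarrow> real^'a \<Rightarrow> real" where
  "pi_inner \<pi> f g = (\<Sum>x\<in>UNIV. pmf \<pi> x * f $ x * g $ x)"

definition pi_adjoint :: "'a pmf \<Rightarrow> real^'a^'a \<Rightarrow> real^'a::finite^'a" where
  "pi_adjoint \<pi> A = (\<chi> x y. pmf \<pi> y * A $ y $ x / pmf \<pi> x)"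

definition pi_frobenius_norm :: "'a pmf \<Rightarrow> real^'a^'a::finite \<Rightarrow> real" where
  "pi_frobenius_norm \<pi> A = sqrt (trace (pi_adjoint \<pi> A ** A))"

lemma pi_adjoint:
  assumes "\<And>x. pmf \<pi> x > 0"
  shows "pi_inner \<pi> (A *v f) g = pi_inner \<pi> f (pi_adjoint \<pi> A *v g)"
proof -
  have nz: "pmf \<pi> x \<noteq> 0" for x
    using assms[of x] by simp
  have "pi_inner \<pi> (A *v f) g = (\<Sum>x\<in>UNIV. \<Sum>y\<in>UNIV. pmf \<pi> x * A $ x $ y * f $ y * g $ x)"
    by (simp add: pi_inner_def matrix_vector_mult_def sum_distrib_left sum_distrib_right ac_simps)
  also have "\<dots> = (\<Sum>y\<in>UNIV. \<Sum>x\<in>UNIV. pmf \<pi> x * A $ x $ y * f $ y * g $ x)"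
    by (rule sum.swap)
  also have "\<dots> = pi_inner \<pi> f (pi_adjoint \<pi> A *v g)"
    by (simp add: pi_inner_def pi_adjoint_def matrix_vector_mult_def sum_distrib_left nz ac_simps)
  finally show ?thesis .
qed

lemma pi_frobenius_norm_sq:
  "(pi_frobenius_norm \<pi> A)\<^sup>2 = (\<Sum>x\<in>UNIV. \<Sum>y\<in>UNIV. pmf \<pi> x / pmf \<pi> y * (A $ x $ y)\<^sup>2)"
proof -
  have "trace (pi_adjoint \<pi> A ** A) =
      (\<Sum>y\<in>UNIV. \<Sum>x\<in>UNIV. pmf \<pi> x / pmf \<pi> y * (A $ x $ y)\<^sup>2)"
    by (simp add: trace_def matrix_matrix_mult_def pi_adjoint_def power2_eq_square ac_simps)
  also have "\<dots> = (\<Sum>x\<in>UNIV. \<Sum>y\<in>UNIV. pmf \<pi> x / pmf \<pi> y * (A $ x $ y)\<^sup>2)"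
    by (rule sum.swap)
  finally show ?thesis
    unfolding pi_frobenius_norm_def by (simp add: sum_nonneg)
qed

definition stationary_matrix :: "'a::finite pmf \<Rightarrow> real^'a^'a" where
  "stationary_matrix \<pi> = (\<chi> x y. pmf \<pi> y)"

section \<open>Partitions into labelled blocks\<close>

definition block_partition :: "nat \<Rightarrow> (nat \<Rightarrow> 'a set) \<Rightarrow> bool" where
  "block_partition k \<O> \<longleftrightarrow> inj_on \<O> {1..k} \<and> partition_on UNIV (\<O> ` {1..k})"

definition gibbs_matrix :: "'a::finite pmf \<Rightarrow> nat \<Rightarrow> (nat \<Rightarrow> 'a set) \<Rightarrow> real^'a^'a" where
  "gibbs_matrix \<pi> k \<O> = (\<chi> x y. \<Sum>i=1..k.
     indicator (\<O> i) x * indicator (\<O> i) y * pmf \<pi> y / measure_pmf.prob \<pi> (\<O> i))"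

definition partition_objective ::
    "'a::finite pmf \<Rightarrow> ('a \<Rightarrow> 'a pmf) \<Rightarrow> nat \<Rightarrow> (nat \<Rightarrow> 'a set) \<Rightarrow> real" where
  "partition_objective \<pi> P k \<O> =
     (pi_frobenius_norm \<pi> (gibbs_matrix \<pi> k \<O> ** kernel_matrix P - stationary_matrix \<pi>))\<^sup>2"

definition Ncut :: "'a pmf \<Rightarrow> real^'a^'a \<Rightarrow> nat \<Rightarrow> (nat \<Rightarrow> 'a::finite set) \<Rightarrow> real" where
  "Ncut \<pi> B k \<O> = (\<Sum>i=1..k. 1 / measure_pmf.prob \<pi> (\<O> i) *
     (\<Sum>x\<in>\<O> i. \<Sum>y\<in>- \<O> i. pmf \<pi> x * B $ x $ y))"

section \<open>Chi-square divergence and information\<close>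

text \<open>For probability measures on the same finite space in which singletons are measurable.\<close>

definition chi_square :: "'b measure \<Rightarrow> 'b measure \<Rightarrow> real" where
  "chi_square \<mu> \<nu> = (\<Sum>y\<in>space \<nu>. (measure \<mu> {y} - measure \<nu> {y})\<^sup>2 / measure \<nu> {y})"

text \<open>The finite sets \<open>A\<close> and \<open>B\<close> are the value spaces of \<open>U\<close> and \<open>V\<close>.  Values of probability
  zero contribute \<open>0 / 0 = 0\<close>.\<close>

definition chi_square_information ::
    "'w measure \<Rightarrow> 'b set \<Rightarrow> 'c set \<Rightarrow> ('w \<Rightarrow> 'b) \<Rightarrow> ('w \<Rightarrow> 'c) \<Rightarrow> real" where
  "chi_square_information M A B U V =
     chi_square
       (distr M (count_space A \<Otimes>\<^sub>M count_space B) (\<lambda>\<omega>. (U \<omega>, V \<omega>)))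
       (distr M (count_space A) U \<Otimes>\<^sub>M distr M (count_space B) V)"

text \<open>The library's \<open>indep_var\<close> forces both variables to have the same value type.\<close>

definition independent_rvs ::
    "'w measure \<Rightarrow> 'b measure \<Rightarrow> ('w \<Rightarrow> 'b) \<Rightarrow> 'c measure \<Rightarrow> ('w \<Rightarrow> 'c) \<Rightarrow> bool" where
  "independent_rvs M S U T V \<longleftrightarrow>
     U \<in> measurable M S \<and> V \<in> measurable M T \<and>
     prob_space.indep_set M
       (sigma_sets (space M) {U -` A \<inter> space M | A. A \<in> sets S})
       (sigma_sets (space M) {V -` A \<inter> space M | A. A \<in> sets T})"

lemma independent_rvs_eq_indep_var:
  assumes "prob_space M"
  shows "independent_rvs M S U T V \<longleftrightarrow> prob_space.indep_var M S U T V"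
  by (simp add: independent_rvs_def prob_space.indep_var_eq[OF assms])

end

theory Submission
  imports Defs
begin

text \<open>Everything is expressed through the flow \<open>J\<^sub>i(y) = \<Sum>x\<in>O\<^sub>i. \<pi>(x) P(x,y)\<close>, which is the joint law of
  \<open>Z\<close> and \<open>X\<^sub>1\<close>.  The row of \<open>G P\<close> at \<open>x \<in> O\<^sub>i\<close> is \<open>J\<^sub>i / \<pi>(O\<^sub>i)\<close>, so all three expressions for
  the objective are \<open>\<Sum>i,y. (J\<^sub>i(y) - \<pi>(O\<^sub>i) \<pi>(y))\<^sup>2 / (\<pi>(O\<^sub>i) \<pi>(y))
  = \<Sum>i,y. J\<^sub>i(y)\<^sup>2 / (\<pi>(O\<^sub>i) \<pi>(y)) - 1\<close>.  By reversibility \<open>J\<^sub>i(y) = \<pi>(y) P(y,O\<^sub>i)\<close>, hence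
  \<open>\<Sum>y. J\<^sub>i(y)\<^sup>2 / \<pi>(y) = \<Sum>y. J\<^sub>i(y) P(y,O\<^sub>i)\<close> is the mass that two steps of the chain carry from
  \<open>O\<^sub>i\<close> back to \<open>O\<^sub>i\<close>.\<close>

section \<open>Partitions into labelled blocks\<close>

lemma block_partition_sum:
  fixes f :: "'a::finite \<Rightarrow> 'b::comm_monoid_add"
  assumes "block_partition k \<O>"
  shows "(\<Sum>x\<in>UNIV. f x) = (\<Sum>i=1..k. \<Sum>x\<in>\<O> i. f x)"
proof -
  have inj: "inj_on \<O> {1..k}" and part: "partition_on UNIV (\<O> ` {1..k})"
    using assms by (auto simp: block_partition_def)
  \<comment> \<open>Disjointness in \<open>partition_on\<close> is about distinct blocks, not
    distinct labels; injectivity of the labelling bridges the two.\<close>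
  have "\<O> i \<inter> \<O> j = {}" if "i \<in> {1..k}" "j \<in> {1..k}" "i \<noteq> j" for i j
  proof -
    have "\<O> i \<noteq> \<O> j"
      using inj that by (auto dest: inj_onD)
    then show ?thesis
      using partition_onD2[OF part] that by (auto simp: disjoint_def)
  qed
  then have "sum f (\<Union>i\<in>{1..k}. \<O> i) = (\<Sum>i=1..k. \<Sum>x\<in>\<O> i. f x)"
    by (intro sum.UNION_disjoint) auto
  then show ?thesis
    using partition_onD1[OF part] by simp
qed

lemma block_partition_unique:
  assumes "block_partition k \<O>" "i \<in> {1..k}" "j \<in> {1..k}" "x \<in> \<O> i"
  shows "x \<in> \<O> j \<longleftrightarrow> j = i"
proof
  have inj: "inj_on \<O> {1..k}" and part: "partition_on UNIV (\<O> ` {1..k})"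
    using assms(1) by (auto simp: block_partition_def)
  assume "x \<in> \<O> j"
  then have "\<O> i = \<O> j"
    using partition_onD2[OF part] assms(2-4) unfolding disjoint_def by blast
  then show "j = i"
    using inj assms(2,3) by (auto dest: inj_onD)
qed (use assms in simp)

lemma block_partition_nonempty:
  assumes "block_partition k \<O>" "i \<in> {1..k}"
  shows "\<O> i \<noteq> {}"
  using assms by (metis block_partition_def imageI partition_onD3)

lemma block_prob_pos:
  fixes \<pi> :: "'a::finite pmf"
  assumes "\<And>x. pmf \<pi> x > 0" "block_partition k \<O>" "i \<in> {1..k}"
  shows "measure_pmf.prob \<pi> (\<O> i) > 0"
  using assms block_partition_nonempty[OF assms(2,3)]
  by (auto simp: measure_measure_pmf_finite intro!: sum_pos)

section \<open>Flow out of a block\<close>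

text \<open>Kept unnormalised: this is the probability of starting in \<open>B\<close> and stepping
  to \<open>y\<close>, and dividing by the mass of \<open>B\<close> gives the law of the next state
  conditioned on starting in \<open>B\<close>.\<close>

definition block_flow :: "'a::finite pmf \<Rightarrow> ('a \<Rightarrow> 'a pmf) \<Rightarrow> 'a set \<Rightarrow> 'a \<Rightarrow> real" where
  "block_flow \<pi> P B y = (\<Sum>x\<in>B. pmf \<pi> x * pmf (P x) y)"

text \<open>Detailed balance, applied to each summand, turns steps from \<open>B\<close> to
  \<open>y\<close> into steps from \<open>y\<close> to \<open>B\<close>. For \<open>B = UNIV\<close>
  this is stationarity; for a block it produces the squared flow in the cut.\<close>

lemma reversible_flow:
  assumes "reversible_kernel \<pi> P"
  shows "block_flow \<pi> P B y = pmf \<pi> y * measure_pmf.prob (P y) B"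
  using assms
  by (simp add: block_flow_def reversible_kernel_def measure_measure_pmf_finite sum_distrib_left)

lemma sum_block_flow: "(\<Sum>y\<in>UNIV. block_flow \<pi> P B y) = measure_pmf.prob \<pi> B"
proof -
  have "(\<Sum>y\<in>UNIV. block_flow \<pi> P B y) = (\<Sum>x\<in>B. pmf \<pi> x * (\<Sum>y\<in>UNIV. pmf (P x) y))"
    unfolding block_flow_def sum_distrib_left by (rule sum.swap)
  then show ?thesis
    by (simp add: sum_pmf_eq_1 measure_measure_pmf_finite)
qed

text \<open>Only the block containing \<open>x\<close> contributes to row \<open>x\<close> of the
  Gibbs kernel, so that row is \<pi> conditioned on the block and is the same throughout the
  block.\<close>

lemma gibbs_kernel_entry:
  assumes "block_partition k \<O>" "i \<in> {1..k}" "x \<in> \<O> i"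
  shows "(gibbs_matrix \<pi> k \<O> ** kernel_matrix P) $ x $ y
    = block_flow \<pi> P (\<O> i) y / measure_pmf.prob \<pi> (\<O> i)"
proof -
  have "gibbs_matrix \<pi> k \<O> $ x $ z = indicator (\<O> i) z * pmf \<pi> z / measure_pmf.prob \<pi> (\<O> i)" for z
  proof -
    have "gibbs_matrix \<pi> k \<O> $ x $ z = (\<Sum>j\<in>{1..k}. if j = i then
        indicator (\<O> i) z * pmf \<pi> z / measure_pmf.prob \<pi> (\<O> i) else 0)"
      unfolding gibbs_matrix_def vec_lambda_beta
      by (intro sum.cong refl) (simp add: block_partition_unique[OF assms(1,2) _ assms(3)] indicator_def)
    then show ?thesis
      using assms(2) by simp
  qed
  then have "(gibbs_matrix \<pi> k \<O> ** kernel_matrix P) $ x $ y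
      = (\<Sum>z\<in>UNIV. indicator (\<O> i) z * (pmf \<pi> z * pmf (P z) y)) / measure_pmf.prob \<pi> (\<O> i)"
    by (simp add: matrix_matrix_mult_def kernel_matrix_def sum_divide_distrib ac_simps)
  also have "(\<Sum>z\<in>UNIV. indicator (\<O> i) z * (pmf \<pi> z * pmf (P z) y)) = block_flow \<pi> P (\<O> i) y"
    by (simp add: block_flow_def sum_indicator_mult)
  finally show ?thesis .
qed

lemma pmf_block_push:
  fixes \<pi> :: "'a::finite pmf"
  assumes "measure_pmf.prob \<pi> B > 0"
  shows "pmf (bind_pmf (cond_pmf \<pi> B) P) y = block_flow \<pi> P B y / measure_pmf.prob \<pi> B"
proof -
  \<comment> \<open>Conditioning a pmf is meaningful only on a set that meets its support.\<close>
  have ne: "set_pmf \<pi> \<inter> B \<noteq> {}"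
    using assms by (metis measure_pmf_zero_iff less_irrefl)
  have "pmf (bind_pmf (cond_pmf \<pi> B) P) y = (\<Sum>x\<in>UNIV. pmf (cond_pmf \<pi> B) x * pmf (P x) y)"
    by (simp add: pmf_bind integral_measure_pmf[of UNIV])
  also have "\<dots> = (\<Sum>x\<in>UNIV. if x \<in> B then pmf \<pi> x * pmf (P x) y / measure_pmf.prob \<pi> B else 0)"
    by (intro sum.cong) (auto simp: pmf_cond[OF ne])
  also have "\<dots> = block_flow \<pi> P B y / measure_pmf.prob \<pi> B"
    by (simp add: block_flow_def sum.If_cases sum_divide_distrib)
  finally show ?thesis .
qed

text \<open>Since rows agree within a block, the inner sum over \<open>y\<close> does not depend on
  \<open>x\<close>, and the weights \<open>pmf \<pi> x\<close> add up to the mass of the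
  block.\<close>

lemma objective_eq_sum_flow:
  assumes "block_partition k \<O>"
  shows "partition_objective \<pi> P k \<O> = (\<Sum>i=1..k. measure_pmf.prob \<pi> (\<O> i) *
    (\<Sum>y\<in>UNIV. (block_flow \<pi> P (\<O> i) y / measure_pmf.prob \<pi> (\<O> i) - pmf \<pi> y)\<^sup>2 / pmf \<pi> y))"
proof -
  let ?w = "\<lambda>i. measure_pmf.prob \<pi> (\<O> i)"
  have "partition_objective \<pi> P k \<O> = (\<Sum>i=1..k. \<Sum>x\<in>\<O> i. \<Sum>y\<in>UNIV. pmf \<pi> x / pmf \<pi> y *
      ((gibbs_matrix \<pi> k \<O> ** kernel_matrix P) $ x $ y - pmf \<pi> y)\<^sup>2)"
    unfolding partition_objective_def pi_frobenius_norm_sq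
    by (subst block_partition_sum[OF assms, symmetric]) (simp add: stationary_matrix_def)
  also have "\<dots> = (\<Sum>i=1..k. \<Sum>x\<in>\<O> i. pmf \<pi> x *
      (\<Sum>y\<in>UNIV. (block_flow \<pi> P (\<O> i) y / ?w i - pmf \<pi> y)\<^sup>2 / pmf \<pi> y))"
    by (intro sum.cong refl) (simp add: gibbs_kernel_entry[OF assms] sum_distrib_left)
  finally show ?thesis
    by (simp add: measure_measure_pmf_finite flip: sum_distrib_right)
qed

section \<open>Information and independence in terms of point probabilities\<close>

lemma chi_square_information_eq:
  assumes "prob_space M" and fin: "finite A" "finite B"
    and U: "U \<in> measurable M (count_space A)" and V: "V \<in> measurable M (count_space B)"
  shows "chi_square_information M A B U V = (\<Sum>a\<in>A. \<Sum>b\<in>B.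
    (\<P>(\<omega> in M. U \<omega> = a \<and> V \<omega> = b) - \<P>(\<omega> in M. U \<omega> = a) * \<P>(\<omega> in M. V \<omega> = b))\<^sup>2
      / (\<P>(\<omega> in M. U \<omega> = a) * \<P>(\<omega> in M. V \<omega> = b)))"
proof -
  interpret prob_space M by fact
  interpret DU: prob_space "distr M (count_space A) U" using U by (rule prob_space_distr)
  interpret DV: prob_space "distr M (count_space B) V" using V by (rule prob_space_distr)
  have joint: "measure (distr M (count_space A \<Otimes>\<^sub>M count_space B) (\<lambda>\<omega>. (U \<omega>, V \<omega>))) {(a, b)}
      = \<P>(\<omega> in M. U \<omega> = a \<and> V \<omega> = b)" if "a \<in> A" "b \<in> B" for a b
  proof -
    \<comment> \<open>The product sigma-algebra is generated by rectangles; a point is measurable as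
      the rectangle \<open>{a} \<times> {b}\<close>.\<close>
    have "{(a, b)} \<in> sets (count_space A \<Otimes>\<^sub>M count_space B)"
      using that pair_measureI[of "{a}" "count_space A" "{b}" "count_space B"] by simp
    then show ?thesis
      using U V by (subst measure_distr) (auto intro!: arg_cong[where f = "measure M"])
  qed
  have prod: "measure (distr M (count_space A) U \<Otimes>\<^sub>M distr M (count_space B) V) {(a, b)}
      = \<P>(\<omega> in M. U \<omega> = a) * \<P>(\<omega> in M. V \<omega> = b)" if "a \<in> A" "b \<in> B" for a b
  proof -
    have "measure (distr M (count_space A) U \<Otimes>\<^sub>M distr M (count_space B) V) ({a} \<times> {b})
        = measure (distr M (count_space A) U) {a} * measure (distr M (count_space B) V) {b}"
      unfolding measure_def using that
      by (subst DV.emeasure_pair_measure_Times) (auto simp: enn2real_mult)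
    also have "measure (distr M (count_space A) U) {a} = \<P>(\<omega> in M. U \<omega> = a)"
      using U that by (subst measure_distr) (auto intro!: arg_cong[where f = "measure M"])
    also have "measure (distr M (count_space B) V) {b} = \<P>(\<omega> in M. V \<omega> = b)"
      using V that by (subst measure_distr) (auto intro!: arg_cong[where f = "measure M"])
    finally show ?thesis by simp
  qed
  show ?thesis
    unfolding chi_square_information_def chi_square_def sum.cartesian_product
    by (auto simp: space_pair_measure joint prod intro!: sum.cong)
qed

text \<open>Finiteness lets factorisation at points pass to arbitrary value sets by summation; the
  preimages of these sets are an intersection-stable generator, from which independence extends to
  the generated sigma-algebras.\<close>

lemma independent_rvs_count_space_iff:
  assumes "prob_space M" and fin: "finite A" "finite B"
    and U: "U \<in> measurable M (count_space A)" and V: "V \<in> measurable M (count_space B)"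
  shows "independent_rvs M (count_space A) U (count_space B) V \<longleftrightarrow>
    (\<forall>a\<in>A. \<forall>b\<in>B. \<P>(\<omega> in M. U \<omega> = a \<and> V \<omega> = b) = \<P>(\<omega> in M. U \<omega> = a) * \<P>(\<omega> in M. V \<omega> = b))"
    (is "?ind \<longleftrightarrow> ?eq")
proof -
  interpret prob_space M by fact
  let ?GU = "{U -` S \<inter> space M | S. S \<in> sets (count_space A)}"
  let ?GV = "{V -` S \<inter> space M | S. S \<in> sets (count_space B)}"
  have evU: "U -` S \<inter> space M \<in> events" if "S \<subseteq> A" for S
    using measurable_sets[OF U] that by simp
  have evV: "V -` S \<inter> space M \<in> events" if "S \<subseteq> B" for S
    using measurable_sets[OF V] that by simp
  show ?thesis
  proof
    assume ?ind
    then have ind: "indep_set (sigma_sets (space M) ?GU) (sigma_sets (space M) ?GV)"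
      by (simp add: independent_rvs_def)
    show ?eq
    proof (intro ballI)
      fix a b assume ab: "a \<in> A" "b \<in> B"
      have "prob ((U -` {a} \<inter> space M) \<inter> (V -` {b} \<inter> space M))
          = prob (U -` {a} \<inter> space M) * prob (V -` {b} \<inter> space M)"
      proof (rule indep_setD[OF ind])
        show "U -` {a} \<inter> space M \<in> sigma_sets (space M) ?GU"
          using ab by (intro sigma_sets.Basic CollectI exI[of _ "{a}"]) auto
        show "V -` {b} \<inter> space M \<in> sigma_sets (space M) ?GV"
          using ab by (intro sigma_sets.Basic CollectI exI[of _ "{b}"]) auto
      qed
      moreover have "(U -` {a} \<inter> space M) \<inter> (V -` {b} \<inter> space M) = {\<omega> \<in> space M. U \<omega> = a \<and> V \<omega> = b}"
        "U -` {a} \<inter> space M = {\<omega> \<in> space M. U \<omega> = a}" "V -` {b} \<inter> space M = {\<omega> \<in> space M. V \<omega> = b}"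
        by auto
      ultimately show "\<P>(\<omega> in M. U \<omega> = a \<and> V \<omega> = b) = \<P>(\<omega> in M. U \<omega> = a) * \<P>(\<omega> in M. V \<omega> = b)"
        by simp
    qed
  next
    assume eq: ?eq
    \<comment> \<open>The joint event is cut into the disjoint events of single value pairs, and the
      resulting double sum of products is a product of sums.\<close>
    have factor: "prob ((U -` S \<inter> space M) \<inter> (V -` T \<inter> space M))
        = prob (U -` S \<inter> space M) * prob (V -` T \<inter> space M)" if "S \<subseteq> A" "T \<subseteq> B" for S T
    proof -
      have fS: "finite S" "finite T"
        using that fin by (auto intro: finite_subset)
      have evUa: "{\<omega> \<in> space M. U \<omega> = a} \<in> events" if "a \<in> S" for a
      proof -
        have "U -` {a} \<inter> space M = {\<omega> \<in> space M. U \<omega> = a}" by auto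
        then show ?thesis using evU[of "{a}"] that \<open>S \<subseteq> A\<close> by auto
      qed
      have evVb: "{\<omega> \<in> space M. V \<omega> = b} \<in> events" if "b \<in> T" for b
      proof -
        have "V -` {b} \<inter> space M = {\<omega> \<in> space M. V \<omega> = b}" by auto
        then show ?thesis using evV[of "{b}"] that \<open>T \<subseteq> B\<close> by auto
      qed
      have evUV: "{\<omega> \<in> space M. U \<omega> = a \<and> V \<omega> = b} \<in> events" if "a \<in> S" "b \<in> T" for a b
        using evVb[OF that(2)] evUa[OF that(1)] by (rule sets.sets_Collect_conj)
      have "(U -` S \<inter> space M) \<inter> (V -` T \<inter> space M)
          = (\<Union>c\<in>S \<times> T. {\<omega> \<in> space M. U \<omega> = fst c \<and> V \<omega> = snd c})"
        by auto
      then have "prob ((U -` S \<inter> space M) \<inter> (V -` T \<inter> space M))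
          = (\<Sum>c\<in>S \<times> T. \<P>(\<omega> in M. U \<omega> = fst c \<and> V \<omega> = snd c))"
        using fS evUV
        by (simp, intro finite_measure_finite_Union)
           (auto simp: disjoint_family_on_def prod_eq_iff)
      also have "\<dots> = (\<Sum>a\<in>S. \<Sum>b\<in>T. \<P>(\<omega> in M. U \<omega> = a) * \<P>(\<omega> in M. V \<omega> = b))"
        using eq subsetD[OF that(1)] subsetD[OF that(2)]
        by (auto simp: sum.cartesian_product intro!: sum.cong)
      also have "\<dots> = (\<Sum>a\<in>S. \<P>(\<omega> in M. U \<omega> = a)) * (\<Sum>b\<in>T. \<P>(\<omega> in M. V \<omega> = b))"
        by (simp add: sum_product)
      also have "(\<Sum>a\<in>S. \<P>(\<omega> in M. U \<omega> = a)) = prob (\<Union>a\<in>S. {\<omega> \<in> space M. U \<omega> = a})"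
        using fS evUa
        by (intro finite_measure_finite_Union[symmetric]) (auto simp: disjoint_family_on_def)
      also have "(\<Union>a\<in>S. {\<omega> \<in> space M. U \<omega> = a}) = U -` S \<inter> space M"
        by auto
      also have "(\<Sum>b\<in>T. \<P>(\<omega> in M. V \<omega> = b)) = prob (\<Union>b\<in>T. {\<omega> \<in> space M. V \<omega> = b})"
        using fS evVb
        by (intro finite_measure_finite_Union[symmetric]) (auto simp: disjoint_family_on_def)
      also have "(\<Union>b\<in>T. {\<omega> \<in> space M. V \<omega> = b}) = V -` T \<inter> space M"
        by auto
      finally show ?thesis .
    qed
    have "indep_set ?GU ?GV"
      unfolding indep_sets2_eq using evU evV factor by auto
    then have "indep_set (sigma_sets (space M) ?GU) (sigma_sets (space M) ?GV)"
    proof (rule indep_set_sigma_sets)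
      show "Int_stable ?GU"
      proof (rule Int_stableI)
        fix a b assume "a \<in> ?GU" "b \<in> ?GU"
        then obtain S T where "S \<subseteq> A" "T \<subseteq> A" "a = U -` S \<inter> space M" "b = U -` T \<inter> space M"
          by auto
        then show "a \<inter> b \<in> ?GU"
          by (intro CollectI exI[of _ "S \<inter> T"]) auto
      qed
      show "Int_stable ?GV"
      proof (rule Int_stableI)
        fix a b assume "a \<in> ?GV" "b \<in> ?GV"
        then obtain S T where "S \<subseteq> B" "T \<subseteq> B" "a = V -` S \<inter> space M" "b = V -` T \<inter> space M"
          by auto
        then show "a \<inter> b \<in> ?GV"
          by (intro CollectI exI[of _ "S \<inter> T"]) auto
      qed
    qed
    then show ?ind
      using U V by (simp add: independent_rvs_def)
  qed
qed

section \<open>Chi-square sums, one step of the chain, and the cut\<close>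

text \<open>Each quotient splits into \<open>J^2 / (u * v) - 2 * J + u * v\<close>, and the total
  masses turn the last two terms into -2 + 1. The array \<open>J\<close> is abstract so that it can
  be the joint law of \<open>Z\<close> with either \<open>X 1\<close> or \<open>X 0\<close>.\<close>

lemma chi_square_sum_expand:
  fixes J :: "'i \<Rightarrow> 'b \<Rightarrow> real"
  assumes "\<And>i. i \<in> I \<Longrightarrow> u i > 0" "\<And>y. y \<in> Y \<Longrightarrow> v y > 0"
    and "(\<Sum>i\<in>I. u i) = 1" "(\<Sum>y\<in>Y. v y) = 1" "(\<Sum>i\<in>I. \<Sum>y\<in>Y. J i y) = 1"
  shows "(\<Sum>i\<in>I. \<Sum>y\<in>Y. (J i y - u i * v y)\<^sup>2 / (u i * v y))
    = (\<Sum>i\<in>I. \<Sum>y\<in>Y. (J i y)\<^sup>2 / (u i * v y)) - 1"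
proof -
  have "(J i y - u i * v y)\<^sup>2 / (u i * v y) = (J i y)\<^sup>2 / (u i * v y) - 2 * J i y + u i * v y"
    if "i \<in> I" "y \<in> Y" for i y
  proof -
    have "u i \<noteq> 0" "v y \<noteq> 0" using assms(1)[OF that(1)] assms(2)[OF that(2)] by auto
    then show ?thesis by (simp add: field_simps power2_eq_square)
  qed
  then have "(\<Sum>i\<in>I. \<Sum>y\<in>Y. (J i y - u i * v y)\<^sup>2 / (u i * v y))
      = (\<Sum>i\<in>I. \<Sum>y\<in>Y. (J i y)\<^sup>2 / (u i * v y)) - 2 * (\<Sum>i\<in>I. \<Sum>y\<in>Y. J i y)
        + (\<Sum>i\<in>I. u i) * (\<Sum>y\<in>Y. v y)"
    by (simp add: sum.distrib sum_subtractf flip: sum_distrib_left sum_distrib_right)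
  then show ?thesis
    using assms(3-5) by simp
qed

lemma markov_chain_one_step:
  assumes chain: "markov_chain M P X" and init: "distr M (count_space UNIV) (X 0) = measure_pmf \<pi>"
  shows "\<P>(\<omega> in M. X 0 \<omega> = x \<and> X 1 \<omega> = y) = pmf \<pi> x * pmf (P x) y"
proof -
  interpret prob_space M using chain by (simp add: markov_chain_def)
  have X [measurable]: "X t \<in> measurable M (count_space UNIV)" for t
    using chain by (simp add: markov_chain_def)
  have "pmf \<pi> x = measure (distr M (count_space UNIV) (X 0)) {x}"
    by (simp add: init measure_pmf_single)
  also have "\<dots> = \<P>(\<omega> in M. X 0 \<omega> = x)"
    by (subst measure_distr) (auto intro!: arg_cong[where f = "measure M"])
  finally have p0: "\<P>(\<omega> in M. X 0 \<omega> = x) = pmf \<pi> x" by simp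
  show ?thesis
  \<comment> \<open>The Markov property speaks only of histories of positive probability. For a null
    starting state the joint event lies inside a null event.\<close>
  proof (cases "pmf \<pi> x = 0")
    case True
    have "\<P>(\<omega> in M. X 0 \<omega> = x \<and> X 1 \<omega> = y) \<le> \<P>(\<omega> in M. X 0 \<omega> = x)"
      by (intro finite_measure_mono) auto
    then show ?thesis
      using True p0 by (simp add: measure_le_0_iff)
  next
    case False
    have "\<P>(\<omega> in M. \<forall>s\<le>0. X s \<omega> = z s) > 0 \<Longrightarrow>
        \<P>(\<omega> in M. X (Suc 0) \<omega> = y \<bar> \<forall>s\<le>0. X s \<omega> = z s) = pmf (P (z 0)) y" for z
      using chain unfolding markov_chain_def by blast
    \<comment> \<open>At time 0 the history is the starting state alone, so a constant path
      serves.\<close>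
    from this[of "\<lambda>_. x"] have "\<P>(\<omega> in M. X (Suc 0) \<omega> = y \<bar> \<forall>s\<le>0. X s \<omega> = (\<lambda>_. x) s) = pmf (P x) y"
      using False p0 by (simp add: pmf_pos)
    then show ?thesis
      using False p0 by (simp add: cond_prob_def conj_commute field_simps)
  qed
qed

text \<open>Of the mass starting in a block, the cut counts what is outside after two steps. By
  reversibility the part that is back inside is the sum of squared flows over
  \<open>pmf \<pi> y\<close>; after normalisation each block gives 1 minus its share, and the ones
  add up to \<open>k\<close>.\<close>

lemma Ncut_square_eq:
  assumes pos: "\<And>x. pmf \<pi> x > 0" and rev: "reversible_kernel \<pi> P" and part: "block_partition k \<O>"
  shows "Ncut \<pi> (kernel_matrix P ** kernel_matrix P) k \<O> = real k -
    (\<Sum>i=1..k. \<Sum>y\<in>UNIV. (block_flow \<pi> P (\<O> i) y)\<^sup>2 / (measure_pmf.prob \<pi> (\<O> i) * pmf \<pi> y))"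
proof -
  let ?w = "\<lambda>i. measure_pmf.prob \<pi> (\<O> i)"
  have "1 / ?w i * (\<Sum>x\<in>\<O> i. \<Sum>y\<in>- \<O> i. pmf \<pi> x * (kernel_matrix P ** kernel_matrix P) $ x $ y)
      = 1 - (\<Sum>y\<in>UNIV. (block_flow \<pi> P (\<O> i) y)\<^sup>2 / (?w i * pmf \<pi> y))" if i: "i \<in> {1..k}" for i
  proof -
    have w: "?w i > 0" using block_prob_pos[OF pos part i] .
    have "(\<Sum>x\<in>\<O> i. \<Sum>y\<in>- \<O> i. pmf \<pi> x * (kernel_matrix P ** kernel_matrix P) $ x $ y)
        = (\<Sum>x\<in>\<O> i. \<Sum>y\<in>- \<O> i. \<Sum>z\<in>UNIV. pmf \<pi> x * pmf (P x) z * pmf (P z) y)"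
      by (simp add: matrix_matrix_mult_def kernel_matrix_def sum_distrib_left ac_simps)
    also have "\<dots> = (\<Sum>x\<in>\<O> i. \<Sum>z\<in>UNIV. \<Sum>y\<in>- \<O> i. pmf \<pi> x * pmf (P x) z * pmf (P z) y)"
      by (intro sum.cong refl sum.swap)
    also have "\<dots> = (\<Sum>z\<in>UNIV. \<Sum>x\<in>\<O> i. \<Sum>y\<in>- \<O> i. pmf \<pi> x * pmf (P x) z * pmf (P z) y)"
      by (rule sum.swap)
    \<comment> \<open>With the intermediate state \<open>z\<close> fixed, arriving at
      \<open>z\<close> from the block and leaving \<open>z\<close> for the complement separate into
      two factors.\<close>
    also have "\<dots> = (\<Sum>z\<in>UNIV. block_flow \<pi> P (\<O> i) z * measure_pmf.prob (P z) (- \<O> i))"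
      by (simp add: block_flow_def sum_product measure_measure_pmf_finite)
    also have "\<dots> = (\<Sum>z\<in>UNIV. block_flow \<pi> P (\<O> i) z - (block_flow \<pi> P (\<O> i) z)\<^sup>2 / pmf \<pi> z)"
    proof (intro sum.cong refl)
      fix z
      have "measure_pmf.prob (P z) (- \<O> i) = 1 - measure_pmf.prob (P z) (\<O> i)"
        using measure_pmf.prob_compl[of "\<O> i" "P z"] by (simp add: Compl_eq_Diff_UNIV)
      also have "measure_pmf.prob (P z) (\<O> i) = block_flow \<pi> P (\<O> i) z / pmf \<pi> z"
        using pos[of z] by (simp add: reversible_flow[OF rev])
      finally have compl: "measure_pmf.prob (P z) (- \<O> i) = 1 - block_flow \<pi> P (\<O> i) z / pmf \<pi> z" .
      show "block_flow \<pi> P (\<O> i) z * measure_pmf.prob (P z) (- \<O> i)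
          = block_flow \<pi> P (\<O> i) z - (block_flow \<pi> P (\<O> i) z)\<^sup>2 / pmf \<pi> z"
        unfolding compl by (simp add: algebra_simps power2_eq_square)
    qed
    also have "\<dots> = ?w i - (\<Sum>z\<in>UNIV. (block_flow \<pi> P (\<O> i) z)\<^sup>2 / pmf \<pi> z)"
      by (simp add: sum_subtractf sum_block_flow)
    finally show ?thesis
      using w by (simp add: right_diff_distrib sum_divide_distrib divide_divide_eq_left mult.commute)
  qed
  then have "Ncut \<pi> (kernel_matrix P ** kernel_matrix P) k \<O>
      = (\<Sum>i=1..k. 1 - (\<Sum>y\<in>UNIV. (block_flow \<pi> P (\<O> i) y)\<^sup>2 / (?w i * pmf \<pi> y)))"
    unfolding Ncut_def by (intro sum.cong) auto
  then show ?thesis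
    by (simp add: sum_subtractf)
qed

section \<open>Chi-square identities for the partitioned chain\<close>

theorem mainTheorem2:
  fixes \<pi> :: "'a::finite pmf"
    and P :: "'a \<Rightarrow> 'a pmf"
    and k :: nat
    and \<O> :: "nat \<Rightarrow> 'a set"
    and M :: "'w measure"
    and X :: "nat \<Rightarrow> 'w \<Rightarrow> 'a"
    and Z :: "'w \<Rightarrow> nat"
  assumes card: "CARD('a) \<ge> 3"
    and pos: "\<And>x. pmf \<pi> x > 0"
    and ergodic: "ergodic_kernel P"
    and reversible: "reversible_kernel \<pi> P"
    and part: "block_partition k \<O>"
    and chain: "markov_chain M P X"
    and init: "distr M (count_space UNIV) (X 0) = measure_pmf \<pi>"
    and Z_range: "\<And>\<omega>. \<omega> \<in> space M \<Longrightarrow> Z \<omega> \<in> {1..k}"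
    and Z_iff: "\<And>\<omega> i. \<omega> \<in> space M \<Longrightarrow> i \<in> {1..k} \<Longrightarrow> Z \<omega> = i \<longleftrightarrow> X 0 \<omega> \<in> \<O> i"
  shows "partition_objective \<pi> P k \<O> =
           (\<Sum>i=1..k. measure_pmf.prob \<pi> (\<O> i) *
              chi_square (bind_pmf (cond_pmf \<pi> (\<O> i)) P) \<pi>) \<and>
         partition_objective \<pi> P k \<O> = chi_square_information M {1..k} UNIV Z (X 1) \<and>
         (partition_objective \<pi> P k \<O> = 0 \<longleftrightarrow>
           independent_rvs M (count_space {1..k}) Z (count_space UNIV) (X 1)) \<and>
         chi_square_information M {1..k} UNIV Z (X 0) = real k - 1 \<and>
         Ncut \<pi> (kernel_matrix P ** kernel_matrix P) k \<O> =
           chi_square_information M {1..k} UNIV Z (X 0)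
           - chi_square_information M {1..k} UNIV Z (X 1)"
proof -
  let ?w = "\<lambda>i. measure_pmf.prob \<pi> (\<O> i)" and ?J = "\<lambda>i. block_flow \<pi> P (\<O> i)"
  interpret prob_space M using chain by (simp add: markov_chain_def)
  have X [measurable]: "X t \<in> measurable M (count_space UNIV)" for t
    using chain by (simp add: markov_chain_def)
  have w: "?w i > 0" if "i \<in> {1..k}" for i
    using block_prob_pos[OF pos part that] .
  have Z_ev: "{\<omega> \<in> space M. Z \<omega> = i} = {\<omega> \<in> space M. X 0 \<omega> \<in> \<O> i}" if "i \<in> {1..k}" for i
    using Z_iff[OF _ that] by auto
  have Z [measurable]: "Z \<in> measurable M (count_space {1..k})"
  \<comment> \<open>The value space is finite, so preimages of single labels suffice.\<close>
  proof (subst measurable_count_space_eq2, safe)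
    fix i assume "i \<in> {1..k}"
    then have "Z -` {i} \<inter> space M = {\<omega> \<in> space M. X 0 \<omega> \<in> \<O> i}"
      using Z_ev by auto
    then show "Z -` {i} \<inter> space M \<in> events"
      by simp
  qed (use Z_range in auto)

  \<comment> \<open>Laws of \<open>Z\<close>, \<open>X 0\<close>, \<open>X 1\<close> and their
    pairs\<close>
  have X0_law: "\<P>(\<omega> in M. X 0 \<omega> \<in> S) = measure_pmf.prob \<pi> S" for S
    unfolding init[symmetric] by (subst measure_distr) (auto intro!: arg_cong[where f = prob])
  have Z_law: "\<P>(\<omega> in M. Z \<omega> = i) = ?w i" if "i \<in> {1..k}" for i
    using Z_ev[OF that] X0_law by simp
  have step: "\<P>(\<omega> in M. X 0 \<omega> \<in> S \<and> X 1 \<omega> = y) = block_flow \<pi> P S y" for S y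
  proof -
    have "{\<omega> \<in> space M. X 0 \<omega> \<in> S \<and> X 1 \<omega> = y} = (\<Union>x\<in>S. {\<omega> \<in> space M. X 0 \<omega> = x \<and> X 1 \<omega> = y})"
      by auto
    also have "prob \<dots> = (\<Sum>x\<in>S. \<P>(\<omega> in M. X 0 \<omega> = x \<and> X 1 \<omega> = y))"
      by (intro finite_measure_finite_Union) (auto simp: disjoint_family_on_def)
    finally show ?thesis
      by (simp only: markov_chain_one_step[OF chain init] block_flow_def)
  qed
  \<comment> \<open>Stationarity: the flow from the whole space into \<open>y\<close> is
    \<open>pmf \<pi> y\<close> times the total mass 1 of \<open>P y\<close>.\<close>
  have X1_law: "\<P>(\<omega> in M. X 1 \<omega> = y) = pmf \<pi> y" for y
    using step[of UNIV y] by (simp add: reversible_flow[OF reversible])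
  have ZX1: "\<P>(\<omega> in M. Z \<omega> = i \<and> X 1 \<omega> = y) = ?J i y" if "i \<in> {1..k}" for i y
  proof -
    have "{\<omega> \<in> space M. Z \<omega> = i \<and> X 1 \<omega> = y} = {\<omega> \<in> space M. X 0 \<omega> \<in> \<O> i \<and> X 1 \<omega> = y}"
      using Z_ev[OF that] by blast
    then show ?thesis using step by simp
  qed
  \<comment> \<open>As \<open>Z\<close> is determined by \<open>X 0\<close>, the joint event is
    either that of \<open>X 0\<close> being \<open>y\<close> or empty.\<close>
  have ZX0: "\<P>(\<omega> in M. Z \<omega> = i \<and> X 0 \<omega> = y) = indicator (\<O> i) y * pmf \<pi> y" if "i \<in> {1..k}" for i y
  proof -
    have "{\<omega> \<in> space M. Z \<omega> = i \<and> X 0 \<omega> = y} = {\<omega> \<in> space M. X 0 \<omega> \<in> \<O> i \<inter> {y}}"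
      using Z_ev[OF that] by blast
    then have "\<P>(\<omega> in M. Z \<omega> = i \<and> X 0 \<omega> = y) = measure_pmf.prob \<pi> (\<O> i \<inter> {y})"
      by (simp only: X0_law)
    also have "\<dots> = indicator (\<O> i) y * pmf \<pi> y"
      by (cases "y \<in> \<O> i") (auto simp: measure_pmf_single)
    finally show ?thesis .
  qed
  have X0_single: "\<P>(\<omega> in M. X 0 \<omega> = y) = pmf \<pi> y" for y
    using X0_law[of "{y}"] by (simp add: measure_pmf_single)

  \<comment> \<open>Evaluation of the two informations and of the objective\<close>
  have sum_p: "(\<Sum>y\<in>UNIV. pmf \<pi> y) = 1"
    by (simp add: sum_pmf_eq_1)
  have sum_w: "(\<Sum>i=1..k. ?w i) = 1"
    using sum_p by (simp add: block_partition_sum[OF part] measure_measure_pmf_finite)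
  \<comment> \<open>\<open>One_nat_def\<close> would rewrite \<open>X 1\<close> to
    \<open>X (Suc 0)\<close>, and the computed laws would no longer match.\<close>
  have info1: "chi_square_information M {1..k} UNIV Z (X 1)
      = (\<Sum>i=1..k. \<Sum>y\<in>UNIV. (?J i y - ?w i * pmf \<pi> y)\<^sup>2 / (?w i * pmf \<pi> y))"
    by (subst chi_square_information_eq[OF prob_space_axioms _ _ Z X])
       (auto simp del: One_nat_def simp: ZX1 Z_law X1_law intro!: sum.cong)
  have info1': "chi_square_information M {1..k} UNIV Z (X 1)
      = (\<Sum>i=1..k. \<Sum>y\<in>UNIV. (?J i y)\<^sup>2 / (?w i * pmf \<pi> y)) - 1"
    unfolding info1 by (rule chi_square_sum_expand) (use w pos sum_p sum_w in \<open>auto simp: sum_block_flow\<close>)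
  have info0: "chi_square_information M {1..k} UNIV Z (X 0) = real k - 1"
  proof -
    have "chi_square_information M {1..k} UNIV Z (X 0)
        = (\<Sum>i=1..k. \<Sum>y\<in>UNIV. (indicator (\<O> i) y * pmf \<pi> y - ?w i * pmf \<pi> y)\<^sup>2 / (?w i * pmf \<pi> y))"
      by (subst chi_square_information_eq[OF prob_space_axioms _ _ Z X])
         (auto simp: ZX0 Z_law X0_single intro!: sum.cong)
    also have "\<dots> = (\<Sum>i=1..k. \<Sum>y\<in>UNIV. (indicator (\<O> i) y * pmf \<pi> y)\<^sup>2 / (?w i * pmf \<pi> y)) - 1"
    proof (rule chi_square_sum_expand)
      show "(\<Sum>i=1..k. \<Sum>y\<in>UNIV. indicator (\<O> i) y * pmf \<pi> y) = 1"
        using sum_w by (simp add: sum_indicator_mult measure_measure_pmf_finite)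
    qed (use w pos sum_p sum_w in auto)
    \<comment> \<open>The indicator is idempotent and one factor \<open>pmf \<pi> y\<close> cancels,
      so each block contributes its mass divided by its mass.\<close>
    also have "(\<Sum>i=1..k. \<Sum>y\<in>UNIV. (indicator (\<O> i) y * pmf \<pi> y)\<^sup>2 / (?w i * pmf \<pi> y)) = (\<Sum>i=1..k. 1)"
    proof (intro sum.cong refl)
      fix i assume i: "i \<in> {1..k}"
      have "(indicator (\<O> i) y * pmf \<pi> y)\<^sup>2 / (?w i * pmf \<pi> y) = indicator (\<O> i) y * pmf \<pi> y / ?w i" for y
        using pos[of y] by (simp add: indicator_def power2_eq_square)
      then show "(\<Sum>y\<in>UNIV. (indicator (\<O> i) y * pmf \<pi> y)\<^sup>2 / (?w i * pmf \<pi> y)) = 1"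
        using w[OF i] by (simp add: sum_indicator_mult measure_measure_pmf_finite flip: sum_divide_distrib)
    qed
    finally show ?thesis by simp
  qed
  have chi: "partition_objective \<pi> P k \<O> =
      (\<Sum>i=1..k. ?w i * chi_square (bind_pmf (cond_pmf \<pi> (\<O> i)) P) \<pi>)"
    unfolding objective_eq_sum_flow[OF part] chi_square_def
    by (intro sum.cong refl) (simp add: measure_pmf_single pmf_block_push w)
  \<comment> \<open>Pulling the block mass into the square turns deviations of conditional laws into
    deviations of the joint law from the product law.\<close>
  have obj_info: "partition_objective \<pi> P k \<O> = chi_square_information M {1..k} UNIV Z (X 1)"
    unfolding objective_eq_sum_flow[OF part] info1 sum_distrib_left
  proof (intro sum.cong refl)
    fix i y assume "i \<in> {1..k}"
    then show "?w i * ((?J i y / ?w i - pmf \<pi> y)\<^sup>2 / pmf \<pi> y) = (?J i y - ?w i * pmf \<pi> y)\<^sup>2 / (?w i * pmf \<pi> y)"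
      using w[of i] pos[of y] by (simp add: field_simps power2_eq_square)
  qed
  have "partition_objective \<pi> P k \<O> = 0 \<longleftrightarrow> (\<forall>i\<in>{1..k}. \<forall>y\<in>UNIV. ?J i y = ?w i * pmf \<pi> y)"
  proof -
    have pw: "0 \<le> (?J i y - ?w i * pmf \<pi> y)\<^sup>2 / (?w i * pmf \<pi> y)" for i y
      by simp
    \<comment> \<open>All terms are nonnegative, so the sum vanishes only termwise; nonzero
      denominators exclude zeros from the convention \<open>a / 0 = 0\<close> and force the
      numerators to vanish.\<close>
    have nz: "?w i * pmf \<pi> y \<noteq> 0" if "i \<in> {1..k}" for i y
      using w[OF that] pos[of y] by simp
    show ?thesis
      unfolding obj_info info1 using nz
      by (simp add: sum_nonneg_eq_0_iff sum_nonneg pw del: mult_eq_0_iff)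
  qed
  \<comment> \<open>The termwise condition is exactly factorisation of the joint law of
    \<open>Z\<close> and \<open>X 1\<close> at points.\<close>
  then have ind: "partition_objective \<pi> P k \<O> = 0 \<longleftrightarrow>
      independent_rvs M (count_space {1..k}) Z (count_space UNIV) (X 1)"
    by (subst independent_rvs_count_space_iff[OF prob_space_axioms _ _ Z X])
       (simp_all del: One_nat_def add: ZX1 Z_law X1_law)
  \<comment> \<open>With \<open>S\<close> the double sum in \<open>info1'\<close>, the cut is
    \<open>k - S = (k - 1) - (S - 1)\<close>.\<close>
  show ?thesis
    using chi obj_info ind info0 info1' Ncut_square_eq[OF pos reversible part] by simp
qed

end
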